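(* Consider the two-class (brown/green) loan portfolio model described in the context, with default events $D_i^b$ ($1\le i\le N_b$), $D_j^g$ ($1\le j\le N_g$), exposure weights $\mathbf{u}=(\mathbf{u}^b,\mathbf{u}^g)$ and portfolio loss $L^N(\mathbf{u})=\sum_{i=1}^{N_b}u_i^b\,\mathbb{I}_{D_i^b}+\sum_{j=1}^{N_g}u_j^g\,\mathbb{I}_{D_j^g}$, $N=N_b+N_g$. Suppose that $$\mathbb{E}\big[\mathrm{cov}(\mathbb{I}_{D_i^a},\mathbb{I}_{D_j^c}\mid X_1,X_2)\big]=0\quad\text{for } i\ne j,\ a,c\in\{b,g\},$$ and that $$HHI_{N_b}(\mathbf{u}^b)=\sum_{i=1}^{N_b}(u_i^b)^2\to 0,\qquad HHI_{N_g}(\mathbf{u}^g)=\sum_{j=1}^{N_g}(u_j^g)^2\to 0\qquad\text{as } N_b,N_g\to\infty.$$ Then, as $N_b,N_g\to\infty$, $$L^N(\mathbf{u})-\mathbb{E}[L^N(\mathbf{u})\mid X_1,X_2]\to 0\quad\text{in probability.}$$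
   Context: Model. The classes are $a\in\{b,g\}$ ("brown", "green"). For each class fix parameters $\rho_a\in[0,1)$, $\delta_a\in(-1,1)$ and a default probability $p^{(a)}\in(0,1)$. The systematic factors $X_1$ and $X_2$ are independent, with $X_1\sim N(0,1)$ and $X_2\sim|W|$ where $W\sim N(0,1)$. The idiosyncratic shocks $Z_h^a$ ($a\in\{b,g\}$, $h\ge 1$) are i.i.d. $N(0,1)$ and independent of $(X_1,X_2)$. The log-return of borrower $h$ in class $a$ is $$Y_h^a=\rho_a\sqrt{1-\delta_a^2}\,X_1+\rho_a\delta_a X_2+\sqrt{1-\rho_a^2}\,Z_h^a .$$ All borrowers in class $a$ have the same default threshold $K^a\in\mathbb{R}$, determined by $p^{(a)}=\mathbb{P}(Y_h^a\le K^a)$, and the default event of borrower $h$ is $D_h^a=\{Y_h^a\le K^a\}$; $\mathbb{I}_D$ is the indicator of $D$. For each pair $(N_b,N_g)$, the weights $\mathbf{u}^b=(u_1^b,\dots,u_{N_b}^b)$ and $\mathbf{u}^g=(u_1^g,\dots,u_{N_g}^g)$ are deterministic and nonnegative, with $\sum_i u_i^b+\sum_j u_j^g=1$ (they may depend on $(N_b,N_g)$). *)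

theory Defs
  imports "HOL-Probability.Probability"
begin

datatype loan_class = Brown | Green

text \<open>Borrowers within a class are numbered from 1.\<close>

definition log_return ::
  "(loan_class \<Rightarrow> real) \<Rightarrow> (loan_class \<Rightarrow> real) \<Rightarrow> ('w \<Rightarrow> real) \<Rightarrow> ('w \<Rightarrow> real) \<Rightarrow>
    (loan_class \<Rightarrow> nat \<Rightarrow> 'w \<Rightarrow> real) \<Rightarrow> loan_class \<Rightarrow> nat \<Rightarrow> 'w \<Rightarrow> real" where
  "log_return \<rho> \<delta> X1 X2 Z a h \<omega> =
     \<rho> a * sqrt (1 - (\<delta> a)\<^sup>2) * X1 \<omega> + \<rho> a * \<delta> a * X2 \<omega> + sqrt (1 - (\<rho> a)\<^sup>2) * Z a h \<omega>"

definition default_event ::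
  "'w measure \<Rightarrow> (loan_class \<Rightarrow> real) \<Rightarrow> (loan_class \<Rightarrow> real) \<Rightarrow> (loan_class \<Rightarrow> real) \<Rightarrow>
    ('w \<Rightarrow> real) \<Rightarrow> ('w \<Rightarrow> real) \<Rightarrow> (loan_class \<Rightarrow> nat \<Rightarrow> 'w \<Rightarrow> real) \<Rightarrow>
    loan_class \<Rightarrow> nat \<Rightarrow> 'w set" where
  "default_event M \<rho> \<delta> K X1 X2 Z a h = {\<omega> \<in> space M. log_return \<rho> \<delta> X1 X2 Z a h \<omega> \<le> K a}"

definition sigma_gen2 :: "'w measure \<Rightarrow> ('w \<Rightarrow> real) \<Rightarrow> ('w \<Rightarrow> real) \<Rightarrow> 'w measure" where
  "sigma_gen2 M X1 X2 = vimage_algebra (space M) (\<lambda>\<omega>. (X1 \<omega>, X2 \<omega>)) (borel \<Otimes>\<^sub>M borel)"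

text \<open>Independence of the pair of systematic factors from the process of shocks is stated through
  the generated sigma-algebras, since \<^const>\<open>prob_space.indep_var\<close> requires both random variables to
  take values in the same type.\<close>

locale loan_model = prob_space M
  for M :: "'w measure" +
  fixes \<rho> \<delta> p K :: "loan_class \<Rightarrow> real"
    and X1 X2 :: "'w \<Rightarrow> real"
    and Z :: "loan_class \<Rightarrow> nat \<Rightarrow> 'w \<Rightarrow> real"
  assumes rho: "\<And>a. \<rho> a \<in> {0..<1}"
    and delta: "\<And>a. \<delta> a \<in> {-1<..<1}"
    and default_prob: "\<And>a. p a \<in> {0<..<1}"
    and X1_measurable: "random_variable borel X1"
    and X1_normal: "distr M borel X1 = std_normal_distribution"
    and X2_measurable: "random_variable borel X2"
    and X2_half_normal: "distr M borel X2 = distr std_normal_distribution borel (\<lambda>w. \<bar>w\<bar>)"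
    and X1_X2_indep: "indep_var borel X1 borel X2"
    and Z_normal: "\<And>a h. 1 \<le> h \<Longrightarrow> distr M borel (Z a h) = std_normal_distribution"
    and Z_indep: "indep_vars (\<lambda>_. borel) (\<lambda>(a, h). Z a h) (UNIV \<times> {1..})"
    and X_Z_indep: "indep_set (sets (sigma_gen2 M X1 X2))
      (sets (vimage_algebra (space M) (\<lambda>\<omega>. \<lambda>(a, h)\<in>UNIV \<times> {1..}. Z a h \<omega>)
        (Pi\<^sub>M (UNIV \<times> {1..}) (\<lambda>_. borel))))"
    and threshold: "\<And>a h. 1 \<le> h \<Longrightarrow> p a = prob (default_event M \<rho> \<delta> K X1 X2 Z a h)"

definition cond_cov ::
  "'w measure \<Rightarrow> 'w measure \<Rightarrow> ('w \<Rightarrow> real) \<Rightarrow> ('w \<Rightarrow> real) \<Rightarrow> 'w \<Rightarrow> real" where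
  "cond_cov M F f g =
     real_cond_exp M F (\<lambda>\<omega>. (f \<omega> - real_cond_exp M F f \<omega>) * (g \<omega> - real_cond_exp M F g \<omega>))"

definition portfolio_loss ::
  "(loan_class \<Rightarrow> nat \<Rightarrow> 'w set) \<Rightarrow> nat \<Rightarrow> nat \<Rightarrow> (nat \<Rightarrow> real) \<Rightarrow> (nat \<Rightarrow> real) \<Rightarrow> 'w \<Rightarrow> real" where
  "portfolio_loss D Nb Ng ub ug \<omega> =
     (\<Sum>i=1..Nb. ub i * indicator (D Brown i) \<omega>) + (\<Sum>j=1..Ng. ug j * indicator (D Green j) \<omega>)"

definition HHI :: "nat \<Rightarrow> (nat \<Rightarrow> real) \<Rightarrow> real" where
  "HHI n w = (\<Sum>i=1..n. (w i)\<^sup>2)"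

definition tendsto_in_probability ::
  "'w measure \<Rightarrow> ('i \<Rightarrow> 'w \<Rightarrow> real) \<Rightarrow> ('w \<Rightarrow> real) \<Rightarrow> 'i filter \<Rightarrow> bool" where
  "tendsto_in_probability M f g F \<longleftrightarrow>
     (\<forall>\<epsilon>>0. ((\<lambda>n. measure M {\<omega> \<in> space M. \<bar>f n \<omega> - g \<omega>\<bar> > \<epsilon>}) \<longlongrightarrow> 0) F)"

end

theory Submission
  imports Defs
begin

text \<open>Conditionally on the factors, the loss splits into residuals
  \<open>e = I - E[I | X1, X2]\<close> of the default indicators, which are bounded by 1 and, within a class,
  pairwise orthogonal. Hence the second moment of each class's weighted residual is at most its HHI.
  The hypothesis does not cover the pair consisting of the brown and the green borrower with the same
  index, so no orthogonality is used between the classes: they are separated by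
  \<open>(x + y)\<^sup>2 \<le> 2 x\<^sup>2 + 2 y\<^sup>2\<close>. Chebyshev's inequality concludes.\<close>

definition cond_residual :: "'w measure \<Rightarrow> 'w measure \<Rightarrow> ('w \<Rightarrow> real) \<Rightarrow> 'w \<Rightarrow> real" where
  "cond_residual M F f \<omega> = f \<omega> - real_cond_exp M F f \<omega>"

lemma borel_measurable_cond_residual [measurable]:
  assumes [measurable]: "f \<in> borel_measurable M"
  shows "cond_residual M F f \<in> borel_measurable M"
  using borel_measurable_cond_exp2[of M F f] unfolding cond_residual_def[abs_def] by measurable

context sigma_finite_subalgebra
begin

lemma AE_cond_residual_add:
  assumes "integrable M f" "integrable M g"
  shows "AE x in M. cond_residual M F (\<lambda>x. f x + g x) x =
    cond_residual M F f x + cond_residual M F g x"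
  using real_cond_exp_add[OF assms] by eventually_elim (simp add: cond_residual_def)

text \<open>Conditional expectation is linear only up to a null set, so induction on the index set
  collects one exceptional null set per summand, finitely many in all.\<close>

lemma AE_cond_residual_weighted_sum:
  assumes "\<And>i. i \<in> I \<Longrightarrow> integrable M (f i)"
  shows "AE x in M. cond_residual M F (\<lambda>x. \<Sum>i\<in>I. u i * f i x) x =
    (\<Sum>i\<in>I. u i * cond_residual M F (f i) x)"
  using assms
proof (induction I rule: infinite_finite_induct)
  case (insert i I)
  have int: "integrable M (\<lambda>x. u i * f i x)" "integrable M (\<lambda>x. \<Sum>i\<in>I. u i * f i x)"
    using insert.prems by auto
  have i: "integrable M (f i)"
    using insert.prems by simp
  have IH: "AE x in M. cond_residual M F (\<lambda>x. \<Sum>i\<in>I. u i * f i x) x =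
      (\<Sum>i\<in>I. u i * cond_residual M F (f i) x)"
    using insert by auto
  show ?case
    using AE_cond_residual_add[OF int] IH real_cond_exp_cmult[OF i, of "u i"] insert.hyps
    by (auto simp: cond_residual_def algebra_simps)
\<comment> \<open>Remaining cases: \<open>I\<close> empty, or infinite with the sum 0 by convention.
  Both need the residual of the zero function, which vanishes a.e. because a constant is its own
  conditional expectation.\<close>
qed (use real_cond_exp_F_meas[of "\<lambda>_. 0"] in \<open>auto simp: cond_residual_def\<close>)

end

text \<open>The indicator and, a.e., its conditional expectation both lie in the unit interval, so
  they differ by at most 1.\<close>

lemma (in finite_measure_subalgebra) AE_cond_residual_indicator_le_1:
  assumes [measurable]: "A \<in> sets M"
  shows "AE x in M. \<bar>cond_residual M F (indicator A) x\<bar> \<le> 1"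
proof -
  have int: "integrable M (indicator A :: _ \<Rightarrow> real)"
    by (simp add: less_top[symmetric])
  have "AE x in M. real_cond_exp M F (indicator A) x \<ge> 0"
    by (rule real_cond_exp_ge_c[OF int]) auto
  moreover have "AE x in M. real_cond_exp M F (indicator A) x \<le> 1"
    by (rule real_cond_exp_le_c[OF int]) (auto simp: indicator_def)
  ultimately show ?thesis
    by eventually_elim (auto simp: cond_residual_def indicator_def)
qed

lemma (in finite_measure) integrable_AE_bounded_mult:
  fixes f g :: "'a \<Rightarrow> real"
  assumes [measurable]: "f \<in> borel_measurable M" "g \<in> borel_measurable M"
    and "AE x in M. \<bar>f x\<bar> \<le> 1" "AE x in M. \<bar>g x\<bar> \<le> 1"
  shows "integrable M (\<lambda>x. f x * g x)"
proof (rule integrable_const_bound[where B = 1])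
  show "AE x in M. norm (f x * g x) \<le> 1"
    using assms(3,4) by eventually_elim (auto simp: abs_mult intro: mult_le_one)
qed measurable

text \<open>Tower property: integrating removes the outer conditioning. A vanishing mean conditional
  covariance thus becomes orthogonality of two residuals in L2.\<close>

lemma (in sigma_finite_subalgebra) integral_cond_cov:
  assumes "integrable M (\<lambda>x. cond_residual M F f x * cond_residual M F g x)"
  shows "(\<integral>x. cond_cov M F f g x \<partial>M) =
    (\<integral>x. cond_residual M F f x * cond_residual M F g x \<partial>M)"
  using real_cond_exp_int(2)[OF assms] by (simp add: cond_cov_def cond_residual_def)

text \<open>Pythagoras: in the expanded square the off-diagonal terms integrate to 0, and each
  diagonal term contributes at most the squared weight because residuals are bounded by 1.\<close>

lemma weighted_sum_residual_second_moment:
  fixes u :: "'i \<Rightarrow> real"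
  assumes M: "prob_space M" and F: "subalgebra M F" and "finite I"
    and A: "\<And>i. i \<in> I \<Longrightarrow> A i \<in> sets M"
    and uncorr: "\<And>i j. i \<in> I \<Longrightarrow> j \<in> I \<Longrightarrow> i \<noteq> j \<Longrightarrow>
      (\<integral>x. cond_cov M F (indicator (A i)) (indicator (A j)) x \<partial>M) = 0"
  defines "S \<equiv> \<lambda>x. \<Sum>i\<in>I. u i * cond_residual M F (indicator (A i)) x"
  shows "integrable M (\<lambda>x. (S x)\<^sup>2)" "(\<integral>x. (S x)\<^sup>2 \<partial>M) \<le> (\<Sum>i\<in>I. (u i)\<^sup>2)"
proof -
  interpret prob_space M by fact
  interpret finite_measure_subalgebra M F
    by unfold_locales fact
  define e where "e i = cond_residual M F (indicator (A i))" for i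
  have S2: "(S x)\<^sup>2 = (\<Sum>i\<in>I. \<Sum>j\<in>I. (u i * u j) * (e i x * e j x))" for x
    unfolding S_def e_def power2_eq_square sum_product by (simp add: ac_simps)
  have e_bound: "AE x in M. \<bar>e i x\<bar> \<le> 1" if "i \<in> I" for i
    unfolding e_def by (rule AE_cond_residual_indicator_le_1[OF A[OF that]])
  have [measurable]: "e i \<in> borel_measurable M" if "i \<in> I" for i
    using A[OF that] unfolding e_def by measurable
  have int: "integrable M (\<lambda>x. e i x * e j x)" if "i \<in> I" "j \<in> I" for i j
    using that by (intro integrable_AE_bounded_mult e_bound) auto
  have orth: "(\<integral>x. e i x * e j x \<partial>M) = 0" if "i \<in> I" "j \<in> I" "i \<noteq> j" for i j
    using integral_cond_cov[OF int[OF that(1,2), unfolded e_def]] uncorr[OF that]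
    by (simp add: e_def)
  have diag: "(\<integral>x. e i x * e i x \<partial>M) \<le> 1" if "i \<in> I" for i
  proof (rule integral_le_const[OF int[OF that that]])
    show "AE x in M. e i x * e i x \<le> 1"
      using e_bound[OF that]
      by eventually_elim (auto simp: abs_square_le_1 power2_eq_square[symmetric])
  qed
  show "integrable M (\<lambda>x. (S x)\<^sup>2)"
    unfolding S2 by (intro Bochner_Integration.integrable_sum integrable_mult_right int)
  have "(\<integral>x. (S x)\<^sup>2 \<partial>M) = (\<Sum>i\<in>I. \<Sum>j\<in>I. (u i * u j) * (\<integral>x. e i x * e j x \<partial>M))"
    unfolding S2 by (simp add: int)
  \<comment> \<open>Orthogonality, written as a conditional so that the inner sum collapses to its
    diagonal entry.\<close>
  also have "\<dots> = (\<Sum>i\<in>I. \<Sum>j\<in>I. if j = i then (u i)\<^sup>2 * (\<integral>x. e i x * e i x \<partial>M) else 0)"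
    by (intro sum.cong refl) (auto simp: orth power2_eq_square)
  also have "\<dots> = (\<Sum>i\<in>I. (u i)\<^sup>2 * (\<integral>x. e i x * e i x \<partial>M))"
    using \<open>finite I\<close> by simp
  also have "\<dots> \<le> (\<Sum>i\<in>I. (u i)\<^sup>2 * 1)"
    by (intro sum_mono mult_left_mono diag) auto
  finally show "(\<integral>x. (S x)\<^sup>2 \<partial>M) \<le> (\<Sum>i\<in>I. (u i)\<^sup>2)"
    by simp
qed

context loan_model
begin

lemma subalgebra_sigma_gen2: "subalgebra M (sigma_gen2 M X1 X2)"
  unfolding subalgebra_def
proof
  have [measurable]: "(\<lambda>\<omega>. (X1 \<omega>, X2 \<omega>)) \<in> M \<rightarrow>\<^sub>M borel \<Otimes>\<^sub>M borel"
    using X1_measurable X2_measurable by measurable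
  show "sets (sigma_gen2 M X1 X2) \<subseteq> sets M"
    unfolding sigma_gen2_def by (rule sets_image_in_sets) simp_all
qed (simp add: sigma_gen2_def)

text \<open>Measurability of a shock is read off from \<open>Z_indep\<close>, whose index set starts
  at borrower 1; hence the bound on \<open>h\<close>.\<close>

lemma default_event_measurable:
  assumes "1 \<le> h"
  shows "default_event M \<rho> \<delta> K X1 X2 Z a h \<in> sets M"
proof -
  have "random_variable borel (Z a h)"
    using Z_indep assms by (auto simp: indep_vars_def)
  then show ?thesis
    using X1_measurable X2_measurable unfolding default_event_def log_return_def by measurable
qed

text \<open>The non-asymptotic form of the result: for fixed sizes and weights the deviation is
  controlled by the two concentration indices alone, so the limit only has to be taken on the
  right-hand side.\<close>

lemma portfolio_loss_deviation_bound:
  fixes w v :: "nat \<Rightarrow> real"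
  defines "F \<equiv> sigma_gen2 M X1 X2" and "D \<equiv> default_event M \<rho> \<delta> K X1 X2 Z"
  assumes uncorr: "\<And>a i j. 1 \<le> i \<Longrightarrow> 1 \<le> j \<Longrightarrow> i \<noteq> j \<Longrightarrow>
      (\<integral>x. cond_cov M F (indicator (D a i)) (indicator (D a j)) x \<partial>M) = 0"
    and "0 < \<epsilon>"
  shows "prob {\<omega> \<in> space M. \<bar>cond_residual M F (portfolio_loss D m n w v) \<omega>\<bar> > \<epsilon>}
    \<le> 2 * (HHI m w + HHI n v) / \<epsilon>\<^sup>2"
proof -
  interpret finite_measure_subalgebra M F
    by unfold_locales (simp add: F_def subalgebra_sigma_gen2)
  define S where "S a k u \<omega> = (\<Sum>i=1..k. u i * cond_residual M F (indicator (D a i)) \<omega>)"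
    for a and k :: nat and u :: "nat \<Rightarrow> real" and \<omega>
  let ?L = "portfolio_loss D m n w v"
  let ?R = "cond_residual M F ?L"
  have D_sets [measurable]: "D a i \<in> sets M" if "1 \<le> i" for a i
    unfolding D_def by (rule default_event_measurable[OF that])
  have int: "integrable M (indicator (D a i) :: _ \<Rightarrow> real)" if "i \<in> {1..k}" for a i k
    using D_sets that by (simp add: less_top[symmetric])
  have S_int: "integrable M (\<lambda>\<omega>. (S a k u \<omega>)\<^sup>2)"
    and S_le: "(\<integral>\<omega>. (S a k u \<omega>)\<^sup>2 \<partial>M) \<le> HHI k u" for a k u
    unfolding S_def HHI_def
    by (rule weighted_sum_residual_second_moment[OF prob_space_axioms subalg];
        simp add: D_sets uncorr)+
  have sum_int: "integrable M (\<lambda>\<omega>. \<Sum>i=1..k. u i * indicator (D a i) \<omega>)"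
    for a k and u :: "nat \<Rightarrow> real"
    by (intro Bochner_Integration.integrable_sum integrable_mult_right int)
  have S_AE: "AE \<omega> in M. cond_residual M F (\<lambda>\<omega>. \<Sum>i=1..k. u i * indicator (D a i) \<omega>) \<omega> =
      S a k u \<omega>" for a k and u :: "nat \<Rightarrow> real"
    unfolding S_def by (rule AE_cond_residual_weighted_sum[OF int])
  \<comment> \<open>Exposes the loss as a sum of two functions, the shape in which additivity of
    residuals applies.\<close>
  have L_eq: "?L = (\<lambda>\<omega>. (\<Sum>i=1..m. w i * indicator (D Brown i) \<omega>) +
      (\<Sum>j=1..n. v j * indicator (D Green j) \<omega>))"
    by (simp add: portfolio_loss_def fun_eq_iff)
  have [measurable]: "?L \<in> borel_measurable M"
    unfolding L_eq
    by (intro borel_measurable_integrable Bochner_Integration.integrable_add sum_int)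
  have R_eq: "AE \<omega> in M. ?R \<omega> = S Brown m w \<omega> + S Green n v \<omega>"
    unfolding L_eq
    using AE_cond_residual_add[OF sum_int[of w Brown m] sum_int[of v Green n]]
      S_AE[of w Brown m] S_AE[of v Green n]
    by eventually_elim simp
  let ?B = "\<lambda>\<omega>. 2 * (S Brown m w \<omega>)\<^sup>2 + 2 * (S Green n v \<omega>)\<^sup>2"
  have B_int: "integrable M ?B"
    by (intro Bochner_Integration.integrable_add integrable_mult_right S_int)
  have R_le: "AE \<omega> in M. (?R \<omega>)\<^sup>2 \<le> ?B \<omega>"
    using R_eq
  proof eventually_elim
    case (elim \<omega>)
    then show ?case
      \<comment> \<open>The cross term \<open>2 * x * y\<close> is absorbed into the sum of the two
        squares; this is where the factor 2 in the bound arises.\<close>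
      using sum_squares_bound[of "S Brown m w \<omega>" "S Green n v \<omega>"] by (simp add: power2_sum)
  qed
  have R_int: "integrable M (\<lambda>\<omega>. (?R \<omega>)\<^sup>2)"
    by (rule Bochner_Integration.integrable_bound[OF B_int]) (use R_le in auto)
  \<comment> \<open>Convergence in probability is stated with a strict inequality, Chebyshev's bound
    with a weak one.\<close>
  have "prob {\<omega> \<in> space M. \<bar>?R \<omega>\<bar> > \<epsilon>} \<le> prob {\<omega> \<in> space M. \<bar>?R \<omega>\<bar> \<ge> \<epsilon>}"
    by (intro finite_measure_mono) auto
  also have "\<dots> \<le> (\<integral>\<omega>. (?R \<omega>)\<^sup>2 \<partial>M) / \<epsilon>\<^sup>2"
    using \<open>0 < \<epsilon>\<close> R_int by (intro second_moment_method) auto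
  also have "\<dots> \<le> (\<integral>\<omega>. ?B \<omega> \<partial>M) / \<epsilon>\<^sup>2"
    by (intro divide_right_mono integral_mono_AE R_int B_int R_le) simp
  also have "(\<integral>\<omega>. ?B \<omega> \<partial>M) =
      2 * (\<integral>\<omega>. (S Brown m w \<omega>)\<^sup>2 \<partial>M) + 2 * (\<integral>\<omega>. (S Green n v \<omega>)\<^sup>2 \<partial>M)"
    by (simp add: S_int)
  also have "\<dots> / \<epsilon>\<^sup>2 \<le> 2 * (HHI m w + HHI n v) / \<epsilon>\<^sup>2"
    using S_le[of Brown m w] S_le[of Green n v] by (intro divide_right_mono) auto
  finally show ?thesis .
qed

end


theorem proposition2p1:
  fixes M :: "'w measure"
    and \<rho> \<delta> p K :: "loan_class \<Rightarrow> real"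
    and X1 X2 :: "'w \<Rightarrow> real"
    and Z :: "loan_class \<Rightarrow> nat \<Rightarrow> 'w \<Rightarrow> real"
    and D :: "loan_class \<Rightarrow> nat \<Rightarrow> 'w set"
    and ub ug :: "nat \<Rightarrow> nat \<Rightarrow> nat \<Rightarrow> real"
    and L :: "nat \<Rightarrow> nat \<Rightarrow> 'w \<Rightarrow> real"
  assumes model: "loan_model M \<rho> \<delta> p K X1 X2 Z"
    and D: "D = default_event M \<rho> \<delta> K X1 X2 Z"
    and ub_nonneg: "\<And>Nb Ng i. 1 \<le> Nb \<Longrightarrow> 1 \<le> Ng \<Longrightarrow> i \<in> {1..Nb} \<Longrightarrow> 0 \<le> ub Nb Ng i"
    and ug_nonneg: "\<And>Nb Ng j. 1 \<le> Nb \<Longrightarrow> 1 \<le> Ng \<Longrightarrow> j \<in> {1..Ng} \<Longrightarrow> 0 \<le> ug Nb Ng j"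
    and weights_sum: "\<And>Nb Ng. 1 \<le> Nb \<Longrightarrow> 1 \<le> Ng \<Longrightarrow>
      (\<Sum>i=1..Nb. ub Nb Ng i) + (\<Sum>j=1..Ng. ug Nb Ng j) = 1"
    and L: "\<And>Nb Ng. L Nb Ng = portfolio_loss D Nb Ng (ub Nb Ng) (ug Nb Ng)"
    and cov_zero: "\<And>a c i j. 1 \<le> i \<Longrightarrow> 1 \<le> j \<Longrightarrow> i \<noteq> j \<Longrightarrow>
      integral\<^sup>L M (cond_cov M (sigma_gen2 M X1 X2) (indicator (D a i)) (indicator (D c j))) = 0"
    and HHI_b: "((\<lambda>(Nb, Ng). HHI Nb (ub Nb Ng)) \<longlongrightarrow> 0) (sequentially \<times>\<^sub>F sequentially)"
    and HHI_g: "((\<lambda>(Nb, Ng). HHI Ng (ug Nb Ng)) \<longlongrightarrow> 0) (sequentially \<times>\<^sub>F sequentially)"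
  shows "tendsto_in_probability M
    (\<lambda>(Nb, Ng) \<omega>. L Nb Ng \<omega> - real_cond_exp M (sigma_gen2 M X1 X2) (L Nb Ng) \<omega>) (\<lambda>_. 0)
    (sequentially \<times>\<^sub>F sequentially)"
  unfolding tendsto_in_probability_def
proof (intro allI impI)
  fix \<epsilon> :: real
  assume "0 < \<epsilon>"
  interpret loan_model M \<rho> \<delta> p K X1 X2 Z by fact
  let ?F = "sigma_gen2 M X1 X2"
  \<comment> \<open>The bound as a function of the pair \<open>q\<close>, written with the same case
    abstractions as \<open>HHI_b\<close> and \<open>HHI_g\<close> so that their limits combine
    directly.\<close>
  let ?H = "\<lambda>q. 2 * ((\<lambda>(Nb, Ng). HHI Nb (ub Nb Ng)) q + (\<lambda>(Nb, Ng). HHI Ng (ug Nb Ng)) q) / \<epsilon>\<^sup>2"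
  let ?dev = "\<lambda>q. {\<omega> \<in> space M.
    \<bar>(\<lambda>(Nb, Ng) \<omega>. L Nb Ng \<omega> - real_cond_exp M ?F (L Nb Ng) \<omega>) q \<omega> - 0\<bar> > \<epsilon>}"
  have H: "(?H \<longlongrightarrow> 0) (sequentially \<times>\<^sub>F sequentially)"
    using tendsto_mult[OF tendsto_const[of "2 / \<epsilon>\<^sup>2"] tendsto_add[OF HHI_b HHI_g]] by simp
  \<comment> \<open>The covariance hypothesis enters at \<open>c = a\<close>. The bound holds for
    every pair of sizes, so the sandwich between 0 and \<open>?H\<close> applies everywhere, not
    just eventually.\<close>
  have "prob (?dev q) \<le> ?H q" for q
    using portfolio_loss_deviation_bound[OF cov_zero[unfolded D] \<open>0 < \<epsilon>\<close>]
    by (cases q) (simp add: L D cond_residual_def)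
  then show "((\<lambda>q. prob (?dev q)) \<longlongrightarrow> 0) (sequentially \<times>\<^sub>F sequentially)"
    by (intro tendsto_sandwich[OF _ _ tendsto_const H] always_eventually allI) auto
qed

end
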